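(* Put $$E_Y^{\circ}(K)=\int_{U_Y}dy_1dy_2dy_3\,\widetilde\omega(y_1;v_{y_1})\wedge\widetilde\omega(y_2;v_{y_2})\wedge\widetilde\omega(y_3;v_{y_3})=\int_{U_Y}\frac{\det(\hat v_{y_1}(x),\hat v_{y_2}(x),\hat v_{y_3}(x))}{|y_1-x|^2|y_2-x|^2|y_3-x|^2}\,dy_1dy_2dy_3\,d_{\rm vol}x.$$ Then $E_Y^{\circ}(K)=0$ for any knot $K$.
   Context: $K=f(S^1)$ is an oriented knot in $\mathbb{R}^3$, and for $y\in K$, $v_y$ denotes the unit tangent vector to $K$ at $y$. For $y\in\mathbb{R}^3$, $v\in T_y\mathbb{R}^3\cong\mathbb{R}^3$ and $x\in\mathbb{R}^3\setminus\{y\}$ put $$\hat v(x)=2\left(v\cdot\frac{x-y}{|x-y|}\right)\frac{x-y}{|x-y|}-v,\qquad \tilde v(x)=\frac{\hat v(x)}{|x-y|^2};$$ thus $\hat v_{y_i}(x)$ is the vector $\hat v(x)$ obtained for $y=y_i$, $v=v_{y_i}$. The $1$-form $\widetilde\omega(y;v)$ on $\mathbb{R}^3\setminus\{y\}$ is defined by $\widetilde\omega(y;v)(u)=u\cdot\tilde v(x)$ for $x\in\mathbb{R}^3\setminus\{y\}$ and $u\in T_x\mathbb{R}^3$. Write $y_1\prec y_2\prec y_3$ if the cyclic order of the points $y_1,y_2,y_3\in K$ coincides with the orientation of $K$, and put $$U_Y=\{(y_1,y_2,y_3,x)\;:\;y_1,y_2,y_3\in K,\ x\in\mathbb{R}^3\setminus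 K,\ y_j\ne y_k\ (j\ne k),\ y_1\prec y_2\prec y_3\}\subset K^3\times\mathbb{R}^3.$$ Here $dy_i$ is the arc-length element on $K$, $d_{\rm vol}x$ is the volume element of $\mathbb{R}^3$, and $\det(a,b,c)$ is the determinant of the matrix with columns $a,b,c$. *)

theory Defs
  imports "HOL-Analysis.Analysis"
begin

section \<open>Oriented knots\<close>

definition knot_curve :: "(complex \<Rightarrow> real^3) \<Rightarrow> real \<Rightarrow> real^3" where
  "knot_curve f t = f (cis t)"

definition velocity :: "(complex \<Rightarrow> real^3) \<Rightarrow> real \<Rightarrow> real^3" where
  "velocity f t = vector_derivative (knot_curve f) (at t)"

text \<open>\<open>C\<^sup>1\<close> is the least regularity for which the unit tangent and the arc-length element
  make sense; smooth knots are included.\<close>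

definition knot_param :: "(complex \<Rightarrow> real^3) \<Rightarrow> bool" where
  "knot_param f \<longleftrightarrow>
     inj_on f (sphere 0 1) \<and> knot_curve f C1_differentiable_on UNIV \<and> (\<forall>t. velocity f t \<noteq> 0)"

definition knot :: "(complex \<Rightarrow> real^3) \<Rightarrow> (real^3) set" where
  "knot f = f ` sphere 0 1"

definition unit_tangent :: "(complex \<Rightarrow> real^3) \<Rightarrow> real^3 \<Rightarrow> real^3" where
  "unit_tangent f y =
     (let t = (THE t. t \<in> {0..<2*pi} \<and> knot_curve f t = y)
      in velocity f t /\<^sub>R norm (velocity f t))"

text \<open>The arc-length element, as a Borel measure on the whole of \<open>\<real>\<^sup>3\<close> concentrated on the knot.\<close>

definition arc_length :: "(complex \<Rightarrow> real^3) \<Rightarrow> (real^3) measure" where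
  "arc_length f =
     distr (density (restrict_space lborel {0..<2*pi}) (\<lambda>t. ennreal (norm (velocity f t))))
           borel (knot_curve f)"

definition cyc_ordered :: "(complex \<Rightarrow> real^3) \<Rightarrow> real^3 \<Rightarrow> real^3 \<Rightarrow> real^3 \<Rightarrow> bool" where
  "cyc_ordered f y1 y2 y3 \<longleftrightarrow>
     (\<exists>t1 t2 t3. t1 < t2 \<and> t2 < t3 \<and> t3 < t1 + 2*pi \<and>
        knot_curve f t1 = y1 \<and> knot_curve f t2 = y2 \<and> knot_curve f t3 = y3)"


section \<open>The forms\<close>

definition vhat :: "real^3 \<Rightarrow> real^3 \<Rightarrow> real^3 \<Rightarrow> real^3" where
  "vhat y v x =
     (2 * (v \<bullet> ((x - y) /\<^sub>R norm (x - y)))) *\<^sub>R ((x - y) /\<^sub>R norm (x - y)) - v"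

definition vtilde :: "real^3 \<Rightarrow> real^3 \<Rightarrow> real^3 \<Rightarrow> real^3" where
  "vtilde y v x = vhat y v x /\<^sub>R (norm (x - y))\<^sup>2"

definition omega :: "real^3 \<Rightarrow> real^3 \<Rightarrow> real^3 \<Rightarrow> real^3 \<Rightarrow> real" where
  "omega y v x u = u \<bullet> vtilde y v x"

text \<open>The wedge product of three covectors, normalised so that
  \<open>dx\<^sub>1 \<and> dx\<^sub>2 \<and> dx\<^sub>3\<close> is \<open>1\<close> on the standard basis.\<close>

definition wedge3 ::
    "(real^3 \<Rightarrow> real) \<Rightarrow> (real^3 \<Rightarrow> real) \<Rightarrow> (real^3 \<Rightarrow> real) \<Rightarrow> (3 \<Rightarrow> real^3) \<Rightarrow> real" where
  "wedge3 a b c u =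
     (\<Sum>p | p permutes (UNIV :: 3 set).
        of_int (sign p) * a (u (p 1)) * b (u (p 2)) * c (u (p 3)))"

definition det_columns :: "real^3 \<Rightarrow> real^3 \<Rightarrow> real^3 \<Rightarrow> real" where
  "det_columns a b c = det (transpose (vector [a, b, c] :: real^3^3))"

type_synonym config = "(real^3) \<times> (real^3) \<times> (real^3) \<times> (real^3)"

text \<open>The density with respect to \<open>d\<^sub>v\<^sub>o\<^sub>l x\<close> of a 3-form is its value on the standard basis.\<close>

definition wedge_density :: "(complex \<Rightarrow> real^3) \<Rightarrow> config \<Rightarrow> real" where
  "wedge_density f = (\<lambda>(y1, y2, y3, x).
     wedge3 (omega y1 (unit_tangent f y1) x) (omega y2 (unit_tangent f y2) x)
            (omega y3 (unit_tangent f y3) x) (\<lambda>i. axis i 1))"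

definition det_density :: "(complex \<Rightarrow> real^3) \<Rightarrow> config \<Rightarrow> real" where
  "det_density f = (\<lambda>(y1, y2, y3, x).
     det_columns (vhat y1 (unit_tangent f y1) x) (vhat y2 (unit_tangent f y2) x)
                 (vhat y3 (unit_tangent f y3) x)
     / ((norm (y1 - x))\<^sup>2 * (norm (y2 - x))\<^sup>2 * (norm (y3 - x))\<^sup>2))"


section \<open>Integration over the configuration space\<close>

definition UY :: "(complex \<Rightarrow> real^3) \<Rightarrow> config set" where
  "UY f = {(y1, y2, y3, x).
     y1 \<in> knot f \<and> y2 \<in> knot f \<and> y3 \<in> knot f \<and> x \<notin> knot f \<and>
     y1 \<noteq> y2 \<and> y1 \<noteq> y3 \<and> y2 \<noteq> y3 \<and> cyc_ordered f y1 y2 y3}"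

definition config_measure :: "(complex \<Rightarrow> real^3) \<Rightarrow> config measure" where
  "config_measure f = arc_length f \<Otimes>\<^sub>M (arc_length f \<Otimes>\<^sub>M (arc_length f \<Otimes>\<^sub>M lborel))"

text \<open>The integrand of \<open>E\<^sub>Y\<close> is in general \<^emph>\<open>not\<close> absolutely integrable over \<open>U\<^sub>Y\<close>: the part of \<open>U\<^sub>Y\<close> where \<open>x\<close> and two of the \<open>y\<^sub>i\<close> are close to each other and the
  third \<open>y\<^sub>i\<close> is far away contributes a logarithmic divergence. The Bochner integral over
  \<open>U\<^sub>Y\<close> would then be 0 by convention only. So \<open>\<integral>\<^bsub>U\<^sub>Y\<^esub>\<close> is read as an improper integral, the limit
  of the (absolutely convergent) integrals over the points of \<open>U\<^sub>Y\<close> with \<open>x\<close> at distance greater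
  than \<open>\<delta>\<close> from the knot. Lemma \<open>has_UY_integral_absolute\<close> below shows that this agrees with
  the Lebesgue integral in the absolutely integrable case.\<close>

definition UY_away :: "(complex \<Rightarrow> real^3) \<Rightarrow> real \<Rightarrow> config set" where
  "UY_away f \<delta> = {(y1, y2, y3, x) \<in> UY f. infdist x (knot f) > \<delta>}"

definition has_UY_integral :: "(complex \<Rightarrow> real^3) \<Rightarrow> (config \<Rightarrow> real) \<Rightarrow> real \<Rightarrow> bool" where
  "has_UY_integral f F E \<longleftrightarrow>
     (\<forall>\<delta>>0. set_integrable (config_measure f) (UY_away f \<delta>) F) \<and>
     ((\<lambda>\<delta>. set_lebesgue_integral (config_measure f) (UY_away f \<delta>) F) \<longlongrightarrow> E) (at_right 0)"

text \<open>The other reading of a conditionally convergent integral over \<open>U\<^sub>Y\<close>: integrate over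
  \<open>y\<^sub>1, y\<^sub>2, y\<^sub>3\<close> first, for fixed \<open>x\<close>, and then over \<open>x\<close>.\<close>

definition has_UY_iterated_integral ::
    "(complex \<Rightarrow> real^3) \<Rightarrow> (config \<Rightarrow> real) \<Rightarrow> real \<Rightarrow> bool" where
  "has_UY_iterated_integral f F E \<longleftrightarrow>
     (let M = arc_length f \<Otimes>\<^sub>M (arc_length f \<Otimes>\<^sub>M arc_length f);
          A = (\<lambda>x. {(y1, y2, y3). (y1, y2, y3, x) \<in> UY f});
          G = (\<lambda>x. set_lebesgue_integral M (A x) (\<lambda>(y1, y2, y3). F (y1, y2, y3, x)))
      in (\<forall>x. x \<notin> knot f \<longrightarrow> set_integrable M (A x) (\<lambda>(y1, y2, y3). F (y1, y2, y3, x))) \<and>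
         set_integrable lborel (- knot f) G \<and>
         set_lebesgue_integral lborel (- knot f) G = E)"

definition E_Y :: "(complex \<Rightarrow> real^3) \<Rightarrow> real" where
  "E_Y f = (THE E. has_UY_integral f (wedge_density f) E)"

lemma has_UY_integral_unique:
  assumes "has_UY_integral f F E" "has_UY_integral f F E'"
  shows "E = E'"
  using assms tendsto_unique[OF trivial_limit_at_right_real]
  unfolding has_UY_integral_def by blast

lemma compact_knot:
  assumes "knot_param f"
  shows "compact (knot f)"
proof -
  have "continuous_on UNIV (knot_curve f)"
    using assms C1_differentiable_imp_continuous_on unfolding knot_param_def by blast
  then have "compact (knot_curve f ` {-pi..pi})"
    by (meson compact_Icc compact_continuous_image continuous_on_subset subset_UNIV)
  moreover have "knot_curve f ` {-pi..pi} = knot f"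
  proof (intro equalityI subsetI)
    fix y assume "y \<in> knot f"
    then obtain z where z: "norm z = 1" "y = f z" by (auto simp: knot_def)
    then have "z \<noteq> 0" by auto
    then have "cis (Arg z) = z" using cis_Arg[of z] z by (simp add: sgn_eq)
    moreover have "Arg z \<in> {-pi..pi}" using Arg_bounded[of z] by auto
    ultimately show "y \<in> knot_curve f ` {-pi..pi}"
      unfolding knot_curve_def using z by (metis imageI)
  qed (auto simp: knot_def knot_curve_def)
  ultimately show ?thesis by simp
qed

lemma has_UY_integral_absolute:
  assumes f: "knot_param f" and F: "set_integrable (config_measure f) (UY f) F"
  shows "has_UY_integral f F (set_lebesgue_integral (config_measure f) (UY f) F)"
proof -
  let ?M = "config_measure f"
  let ?g = "\<lambda>q. indicat_real (UY f) q *\<^sub>R F q"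
  define d where "d = (\<lambda>(y1 :: real^3, y2 :: real^3, y3 :: real^3, x). infdist x (knot f))"
  have ne: "knot f \<noteq> {}" by (auto simp: knot_def)
  have gi: "integrable ?M ?g" using F by (simp add: set_integrable_def)
  have sets: "sets ?M = sets borel"
    unfolding config_measure_def arc_length_def by (simp flip: borel_prod cong: sets_pair_measure_cong)
  have dm: "d \<in> borel_measurable ?M"
    unfolding measurable_cong_sets[OF sets refl] d_def
    by (intro borel_measurable_continuous_onI)
       (simp add: case_prod_unfold, intro continuous_intros)
  have eq: "indicat_real (UY_away f \<delta>) q *\<^sub>R F q = indicat_real {q. d q > \<delta>} q *\<^sub>R ?g q" for \<delta> q
    by (auto simp: UY_away_def d_def indicator_def split: prod.splits)
  have meas: "{q. d q > \<delta>} \<in> sets ?M" for \<delta>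
    using measurable_sets[OF dm, of "{\<delta><..}"]
    by (auto simp: vimage_def sets_eq_imp_space_eq[OF sets])
  have int: "integrable ?M (\<lambda>q. indicat_real {q. d q > \<delta>} q *\<^sub>R ?g q)" for \<delta>
    using integrable_mult_indicator[OF meas gi] .
  have "((\<lambda>\<delta>. \<integral>q. indicat_real {q. d q > \<delta>} q *\<^sub>R ?g q \<partial>?M) \<longlongrightarrow> (\<integral>q. ?g q \<partial>?M)) (at_right 0)"
  proof (rule tendsto_at_right_sequentially[of 0 1])
    fix S :: "nat \<Rightarrow> real" assume S: "\<And>n. 0 < S n" "S \<longlonglongrightarrow> 0"
    show "(\<lambda>n. \<integral>q. indicat_real {q. d q > S n} q *\<^sub>R ?g q \<partial>?M) \<longlonglongrightarrow> (\<integral>q. ?g q \<partial>?M)"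
    proof (rule integral_dominated_convergence[where w = "\<lambda>q. norm (?g q)"])
      show "?g \<in> borel_measurable ?M" using gi by simp
      show "(\<lambda>q. indicat_real {q. d q > S n} q *\<^sub>R ?g q) \<in> borel_measurable ?M" for n
        using int by blast
      show "integrable ?M (\<lambda>q. norm (?g q))" using gi by (rule integrable_norm)
      show "AE q in ?M. (\<lambda>n. indicat_real {q. d q > S n} q *\<^sub>R ?g q) \<longlonglongrightarrow> ?g q"
      proof (rule AE_I2)
        fix q
        show "(\<lambda>n. indicat_real {q. d q > S n} q *\<^sub>R ?g q) \<longlonglongrightarrow> ?g q"
        proof (cases "q \<in> UY f")
          case True
          then have "d q > 0"
            using compact_imp_closed[OF compact_knot[OF f]] ne
            by (auto simp: UY_def d_def infdist_pos_not_in_closed split: prod.splits)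
          then have "eventually (\<lambda>n. S n < d q) sequentially"
            using S(2) by (metis order_tendstoD(2))
          then have "eventually (\<lambda>n. indicat_real {q. d q > S n} q *\<^sub>R ?g q = ?g q) sequentially"
            by eventually_elim simp
          then show ?thesis by (rule tendsto_eventually)
        qed simp
      qed
    qed (auto simp: indicator_def)
  qed simp
  then show ?thesis
    using int unfolding has_UY_integral_def set_integrable_def set_lebesgue_integral_def eq by blast
qed

end

theory Submission
  imports Defs
begin

text \<open>Fix a point \<open>x\<close> off the knot and write \<open>k(y)\<close> for the vector dual to the form
  \<open>omega y (unit_tangent f y) x\<close>. Both densities are the triple product
  \<open>k(y\<^sub>1) \<bullet> (k(y\<^sub>2) \<times> k(y\<^sub>3))\<close>. The point is that \<open>k\<close> is exact along the knot: with
  \<open>C(y) = (y - x) / |y - x|\<^sup>2\<close>, the inversion centred at \<open>x\<close>, the chain rule gives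
  \<open>k(y) dy = - dC\<close> (\<open>inversion_curve_derivative\<close>). This makes the integral over
  \<open>y\<^sub>1, y\<^sub>2, y\<^sub>3\<close> elementary.

  For given \<open>y\<^sub>1, y\<^sub>2\<close> the admissible \<open>y\<^sub>3\<close> form the arc that leads from \<open>y\<^sub>2\<close> on to \<open>y\<^sub>1\<close>, so
  the fundamental theorem of calculus gives \<open>\<integral> k(y\<^sub>3) dy\<^sub>3 = C(y\<^sub>2) - C(y\<^sub>1)\<close>
  (\<open>integral_tangent_form_arc\<close>). Over the closed curve the integral of \<open>k\<close> is \<open>0\<close>
  (\<open>integral_tangent_form\<close>). Hence the term with \<open>C(y\<^sub>1)\<close> disappears when
  \<open>k(y\<^sub>1) \<bullet> (k(y\<^sub>2) \<times> (C(y\<^sub>2) - C(y\<^sub>1)))\<close> is integrated over \<open>y\<^sub>2\<close>, and \<open>k(y\<^sub>1) \<bullet> W\<close> remains, with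
  \<open>W = \<integral> k \<times> C\<close> independent of \<open>y\<^sub>1\<close>. Integrating over \<open>y\<^sub>1\<close> gives \<open>0\<close> once more
  (\<open>integral_cyc_density\<close>). Geometrically, the inverted knot is a closed curve, and up to a constant factor the
  integral over \<open>y\<^sub>2, y\<^sub>3\<close> is its area vector, which does not depend on where one starts; pairing a
  constant vector with the tangent of a closed curve gives \<open>0\<close>.

  So the integral over the points of the knot vanishes for every single \<open>x\<close>, which settles the
  iterated integral. For the improper integral it remains to justify that \<open>x\<close> may be integrated last.
  At distance more than \<open>\<delta>\<close> from the knot the density is \<open>O(1 / (1 + |x|)\<^sup>6)\<close>, which is integrable over
  \<open>\<real>\<^sup>3\<close> (\<open>away_density_le_decay\<close>, \<open>nn_integral_decay\<close>), the knot has finite length, and Fubini's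
  theorem applies (\<open>integral_away_density\<close>).\<close>

unbundle cross3_syntax

section \<open>The integrand as a triple product\<close>

text \<open>The values of the three covectors on the standard basis are the entries of the matrix with rows
  \<open>a, b, c\<close>, so the alternating sum is its determinant.\<close>

lemma wedge3_inner:
  "wedge3 (\<lambda>u. u \<bullet> a) (\<lambda>u. u \<bullet> b) (\<lambda>u. u \<bullet> c) (\<lambda>i. axis i 1) = a \<bullet> (b \<times> c)"
proof -
  let ?A = "vector [a, b, c] :: real^3^3"
  have "wedge3 (\<lambda>u. u \<bullet> a) (\<lambda>u. u \<bullet> b) (\<lambda>u. u \<bullet> c) (\<lambda>i. axis i 1) = det ?A"
    unfolding wedge3_def det_def
  proof (rule sum.cong[OF refl], goal_cases)
    case (1 p)
    have "(\<Prod>i\<in>UNIV. ?A $ i $ p i) = ?A $ 1 $ p 1 * (?A $ 2 $ p 2 * ?A $ 3 $ p 3)"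
      unfolding UNIV_3 by simp
    then show ?case by (simp only: inner_axis' vector_3 mult_1 inner_real_def mult.assoc)
  qed
  then show ?thesis by (simp add: dot_cross_det)
qed

lemma det_columns_eq: "det_columns a b c = a \<bullet> (b \<times> c)"
  by (simp add: det_columns_def dot_cross_det det_transpose)

lemma norm_cross_le: "norm (x \<times> y) \<le> norm x * norm (y :: real^3)"
proof -
  have "(norm (x \<times> y))\<^sup>2 \<le> (norm x * norm y)\<^sup>2"
    using norm_cross_dot[of x y] by (metis le_add_same_cancel1 zero_le_power2)
  then show ?thesis by (rule power2_le_imp_le) simp
qed

lemma bounded_bilinear_cross: "bounded_bilinear ((\<times>) :: real^3 \<Rightarrow> real^3 \<Rightarrow> real^3)"
  using bilinear_cross by (simp add: bilinear_conv_bounded_bilinear)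

text \<open>The vector that represents the covector \<open>omega y (unit_tangent f y) x\<close>, regarded for fixed \<open>x\<close> as
  a vector field along the knot.\<close>

definition tangent_form :: "(complex \<Rightarrow> real^3) \<Rightarrow> real^3 \<Rightarrow> real^3 \<Rightarrow> real^3" where
  "tangent_form f x y = vtilde y (unit_tangent f y) x"

definition inversion :: "real^3 \<Rightarrow> real^3 \<Rightarrow> real^3" where
  "inversion x y = (y - x) /\<^sub>R (norm (y - x))\<^sup>2"

lemma wedge_density_triple:
  "wedge_density f (y1, y2, y3, x) =
     tangent_form f x y1 \<bullet> (tangent_form f x y2 \<times> tangent_form f x y3)"
  by (simp add: wedge_density_def omega_def [abs_def] wedge3_inner tangent_form_def)

lemma det_density_eq_wedge_density: "det_density f = wedge_density f"
proof (rule ext)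
  fix q :: config
  obtain y1 y2 y3 x where "q = (y1, y2, y3, x)" by (cases q) auto
  then show "det_density f q = wedge_density f q"
    by (simp add: wedge_density_triple tangent_form_def vtilde_def det_density_def det_columns_eq
          cross_mult_left cross_mult_right norm_minus_commute[of x] divide_inverse mult_ac)
qed

text \<open>The map \<open>v \<mapsto> vhat y v x\<close> is minus a reflection, hence an isometry; for integrability the bound
  from the triangle inequality is enough.\<close>

lemma norm_vhat_le: "norm (vhat y v x) \<le> 3 * norm v"
proof -
  define e where "e = (x - y) /\<^sub>R norm (x - y)"
  have e: "norm e \<le> 1" by (cases "x = y") (auto simp: e_def)
  have "norm (vhat y v x) \<le> norm ((2 * (v \<bullet> e)) *\<^sub>R e) + norm v"
    unfolding vhat_def e_def by (rule norm_triangle_ineq4)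
  also have "norm ((2 * (v \<bullet> e)) *\<^sub>R e) \<le> 2 * norm v"
  proof -
    have "\<bar>v \<bullet> e\<bar> * norm e \<le> (norm v * norm e) * norm e"
      by (intro mult_right_mono Cauchy_Schwarz_ineq2) auto
    also have "\<dots> \<le> norm v * 1"
      unfolding mult.assoc using e by (intro mult_left_mono) (auto simp: mult_le_one)
    finally show ?thesis by simp
  qed
  finally show ?thesis by simp
qed

text \<open>The differential of an inversion is a reflection divided by the squared distance to the centre,
  and \<open>vtilde\<close> is minus this map. So the forms have a primitive along curves, which is what makes
  the whole integral computable.\<close>

lemma inversion_curve_derivative:
  assumes g: "(g has_vector_derivative v) (at t)" and ne: "g t \<noteq> x"
  shows "((\<lambda>t. inversion x (g t)) has_vector_derivative - vtilde (g t) v x) (at t)"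
proof -
  define u where "u = g t - x"
  have u: "norm u \<noteq> 0" "u \<bullet> u \<noteq> 0" using ne by (auto simp: u_def)
  have nn: "(norm w)\<^sup>2 = w \<bullet> w" for w :: "real^3" by (simp add: power2_norm_eq_inner)
  have d: "((\<lambda>t. g t - x) has_vector_derivative v) (at t)"
    using has_vector_derivative_diff[OF g has_vector_derivative_const[of x]] by simp
  have "((\<lambda>t. (g t - x) \<bullet> (g t - x)) has_real_derivative 2 * (v \<bullet> u)) (at t)"
    using bounded_bilinear.has_vector_derivative[OF bounded_bilinear_inner d d]
    by (simp add: has_real_derivative_iff_has_vector_derivative u_def inner_commute)
  from DERIV_inverse_fun[OF this]
  have "((\<lambda>t. inverse ((g t - x) \<bullet> (g t - x))) has_real_derivative
      - (2 * (v \<bullet> u)) / (u \<bullet> u)\<^sup>2) (at t)"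
    using u by (simp add: u_def divide_simps power2_eq_square)
  from has_vector_derivative_scaleR[OF this d]
  have "((\<lambda>t. inverse ((g t - x) \<bullet> (g t - x)) *\<^sub>R (g t - x)) has_vector_derivative
      v /\<^sub>R (u \<bullet> u) - (2 * (v \<bullet> u) / (u \<bullet> u)\<^sup>2) *\<^sub>R u) (at t)"
    by (simp add: u_def)
  moreover have "vtilde (g t) v x = (2 * (v \<bullet> u) / (u \<bullet> u)\<^sup>2) *\<^sub>R u - v /\<^sub>R (u \<bullet> u)"
  proof -
    have 1: "x - g t = - u" by (simp add: u_def)
    show ?thesis
      using u unfolding vtilde_def vhat_def 1 nn[symmetric]
      by (simp add: scaleR_diff_right divide_simps power2_eq_square)
  qed
  ultimately show ?thesis by (simp add: inversion_def [abs_def] nn)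
qed

lemma vtilde_scale: "vtilde y (c *\<^sub>R v) x = c *\<^sub>R vtilde y v x"
  by (simp add: vtilde_def vhat_def scaleR_diff_right mult_ac)

lemma triple_le: "\<bar>a \<bullet> (b \<times> c)\<bar> \<le> norm a * norm b * norm (c :: real^3)"
  using order_trans[OF Cauchy_Schwarz_ineq2 mult_left_mono[OF norm_cross_le norm_ge_zero]]
  by (simp add: mult.assoc)

lemma borel_measurable_cross [measurable]:
  assumes "U \<in> borel_measurable M" "V \<in> borel_measurable M"
  shows "(\<lambda>q. U q \<times> (V q :: real^3)) \<in> borel_measurable M"
  by (rule borel_measurable_continuous_Pair[OF assms])
     (intro continuous_on_cross continuous_intros)

section \<open>Decay at infinity and reordered integration\<close>

lemma nn_integral_inverse_1_plus_square:
  "(\<integral>\<^sup>+t. ennreal (1 / (1 + t\<^sup>2)) \<partial>lborel) < \<infinity>"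
proof -
  have pos: "0 < 1 + t\<^sup>2" for t :: real by (rule add_pos_nonneg) auto
  have half: "(\<integral>\<^sup>+t. ennreal (1 / (1 + t\<^sup>2)) * indicator {0..} t \<partial>lborel) = ennreal (pi / 2)"
  proof -
    have "(\<integral>\<^sup>+t. ennreal (1 / (1 + t\<^sup>2)) * indicator {0..} t \<partial>lborel) = ennreal (pi / 2 - arctan 0)"
    proof (rule nn_integral_FTC_atLeast)
      show "(arctan has_real_derivative 1 / (1 + t\<^sup>2)) (at t)" for t
        using DERIV_arctan[of t] by (simp add: inverse_eq_divide)
      show "0 \<le> 1 / (1 + t\<^sup>2)" for t :: real
        using pos[of t] by simp
    qed (measurable, rule tendsto_arctan_at_top)
    then show ?thesis by simp
  qed
  have "(\<integral>\<^sup>+t. ennreal (1 / (1 + t\<^sup>2)) \<partial>lborel) \<le>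
      (\<integral>\<^sup>+t. ennreal (1 / (1 + t\<^sup>2)) * indicator {0..} t +
            ennreal (1 / (1 + (- t)\<^sup>2)) * indicator {0..} (- t) \<partial>lborel)"
    by (intro nn_integral_mono) (auto split: split_indicator)
  also have "\<dots> = (\<integral>\<^sup>+t. ennreal (1 / (1 + t\<^sup>2)) * indicator {0..} t \<partial>lborel) +
      (\<integral>\<^sup>+t. ennreal (1 / (1 + (- t)\<^sup>2)) * indicator {0..} (- t) \<partial>lborel)"
    by (rule nn_integral_add) measurable
  also have "(\<integral>\<^sup>+t. ennreal (1 / (1 + (- t)\<^sup>2)) * indicator {0..} (- t) \<partial>lborel) = ennreal (pi / 2)"
    using nn_integral_real_affine[of "\<lambda>t. ennreal (1 / (1 + t\<^sup>2)) * indicator {0..} t" "-1" 0] half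
    by simp
  finally show ?thesis by (rule le_less_trans) (simp add: half)
qed

text \<open>An integrable majorant on \<open>\<real>\<^sup>3\<close> in product form, so that its integral is a product of
  one-dimensional integrals.\<close>

definition decay :: "real^3 \<Rightarrow> real" where
  "decay x = (\<Prod>b\<in>Basis. 1 / (1 + (x \<bullet> b)\<^sup>2))"

lemma decay_nonneg: "0 \<le> decay x"
  unfolding decay_def by (intro prod_nonneg) auto

lemma borel_measurable_decay [measurable]: "decay \<in> borel_measurable borel"
  unfolding decay_def [abs_def] by measurable

lemma nn_integral_decay: "(\<integral>\<^sup>+x. ennreal (decay x) \<partial>lborel) < \<infinity>"
proof -
  have "(\<integral>\<^sup>+x. ennreal (decay x) \<partial>lborel) =
      (\<integral>\<^sup>+x. (\<Prod>b\<in>Basis. ennreal (1 / (1 + ((x :: real^3) \<bullet> b)\<^sup>2))) \<partial>lborel)"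
    by (simp add: decay_def prod_ennreal)
  also have "\<dots> = (\<Prod>b\<in>(Basis :: (real^3) set). \<integral>\<^sup>+t. ennreal (1 / (1 + t\<^sup>2)) \<partial>lborel)"
    by (subst nn_integral_lborel_prod) auto
  also have "\<dots> < \<infinity>"
    using nn_integral_inverse_1_plus_square by (simp add: power_less_top_ennreal)
  finally show ?thesis .
qed

text \<open>Each of the three coordinates takes up a factor \<open>(1 + |x|)\<^sup>2\<close>, since none exceeds \<open>|x|\<close> in modulus.\<close>

lemma norm_power_le_decay: "1 / (1 + norm x) ^ 6 \<le> decay x"
proof -
  have "(\<Prod>b\<in>(Basis :: (real^3) set). 1 / (1 + norm x)\<^sup>2) \<le> decay x"
    unfolding decay_def
  proof (rule prod_mono)
    fix b :: "real^3" assume b: "b \<in> Basis"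
    have "\<bar>x \<bullet> b\<bar> \<le> norm x" by (rule Basis_le_norm[OF b])
    then have "(x \<bullet> b)\<^sup>2 \<le> (norm x)\<^sup>2"
      by (metis abs_ge_zero power2_abs power_mono)
    then have "1 + (x \<bullet> b)\<^sup>2 \<le> (1 + norm x)\<^sup>2"
      using norm_ge_zero[of x] by (simp add: power2_sum add_increasing2)
    then have "1 / (1 + norm x)\<^sup>2 \<le> 1 / (1 + (x \<bullet> b)\<^sup>2)"
      by (intro divide_left_mono mult_pos_pos zero_less_power add_pos_nonneg) auto
    then show "0 \<le> 1 / (1 + norm x)\<^sup>2 \<and> 1 / (1 + norm x)\<^sup>2 \<le> 1 / (1 + (x \<bullet> b)\<^sup>2)"
      by simp
  qed
  then show ?thesis
    by (simp add: power_divide flip: power_mult)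
qed

text \<open>The order of the factors in \<open>config_measure\<close> makes \<open>x\<close> the innermost variable, whereas the
  cancellation happens for fixed \<open>x\<close>. Three exchanges of neighbouring integrals bring \<open>x\<close> to the
  outside.\<close>

lemma nn_integral_move_last_outward:
  assumes "sigma_finite_measure M1" "sigma_finite_measure M2" "sigma_finite_measure M3"
    "sigma_finite_measure L"
    and h [measurable]: "h \<in> borel_measurable (M1 \<Otimes>\<^sub>M (M2 \<Otimes>\<^sub>M (M3 \<Otimes>\<^sub>M L)))"
  shows "(\<integral>\<^sup>+q. h q \<partial>(M1 \<Otimes>\<^sub>M (M2 \<Otimes>\<^sub>M (M3 \<Otimes>\<^sub>M L)))) =
    (\<integral>\<^sup>+(x, y1, y2, y3). h (y1, y2, y3, x) \<partial>(L \<Otimes>\<^sub>M (M1 \<Otimes>\<^sub>M (M2 \<Otimes>\<^sub>M M3))))"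
proof -
  interpret M1: sigma_finite_measure M1 by fact
  interpret M2: sigma_finite_measure M2 by fact
  interpret M3: sigma_finite_measure M3 by fact
  interpret L: sigma_finite_measure L by fact
  interpret M1L: pair_sigma_finite M1 L ..
  interpret M2L: pair_sigma_finite M2 L ..
  interpret M3L: pair_sigma_finite M3 L ..
  interpret M23: pair_sigma_finite M2 M3 ..
  interpret M123: pair_sigma_finite M1 "M2 \<Otimes>\<^sub>M M3" ..
  interpret M23L: pair_sigma_finite M2 "M3 \<Otimes>\<^sub>M L" ..
  have "(\<integral>\<^sup>+q. h q \<partial>(M1 \<Otimes>\<^sub>M (M2 \<Otimes>\<^sub>M (M3 \<Otimes>\<^sub>M L)))) =
      (\<integral>\<^sup>+y1. \<integral>\<^sup>+q. h (y1, q) \<partial>(M2 \<Otimes>\<^sub>M (M3 \<Otimes>\<^sub>M L)) \<partial>M1)"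
    by (rule M23L.nn_integral_fst[symmetric]) measurable
  also have "\<dots> = (\<integral>\<^sup>+y1. \<integral>\<^sup>+y2. \<integral>\<^sup>+q. h (y1, y2, q) \<partial>(M3 \<Otimes>\<^sub>M L) \<partial>M2 \<partial>M1)"
    by (intro nn_integral_cong M3L.nn_integral_fst[symmetric]) measurable
  also have "\<dots> = (\<integral>\<^sup>+y1. \<integral>\<^sup>+y2. \<integral>\<^sup>+x. \<integral>\<^sup>+y3. h (y1, y2, y3, x) \<partial>M3 \<partial>L \<partial>M2 \<partial>M1)"
    by (intro nn_integral_cong, subst M3L.nn_integral_snd[symmetric]) measurable
  also have "\<dots> = (\<integral>\<^sup>+y1. \<integral>\<^sup>+x. \<integral>\<^sup>+y2. \<integral>\<^sup>+y3. h (y1, y2, y3, x) \<partial>M3 \<partial>M2 \<partial>L \<partial>M1)"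
    by (intro nn_integral_cong M2L.Fubini'[symmetric]) measurable
  also have "\<dots> = (\<integral>\<^sup>+y1. \<integral>\<^sup>+x. \<integral>\<^sup>+q. h (y1, fst q, snd q, x) \<partial>(M2 \<Otimes>\<^sub>M M3) \<partial>L \<partial>M1)"
    by (intro nn_integral_cong, subst M3.nn_integral_fst[symmetric]) simp_all
  also have "\<dots> = (\<integral>\<^sup>+x. \<integral>\<^sup>+y1. \<integral>\<^sup>+q. h (y1, fst q, snd q, x) \<partial>(M2 \<Otimes>\<^sub>M M3) \<partial>M1 \<partial>L)"
    by (intro M1L.Fubini'[symmetric]) measurable
  also have "\<dots> = (\<integral>\<^sup>+x. \<integral>\<^sup>+q. h (fst q, fst (snd q), snd (snd q), x) \<partial>(M1 \<Otimes>\<^sub>M (M2 \<Otimes>\<^sub>M M3)) \<partial>L)"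
    by (intro nn_integral_cong, subst M23.nn_integral_fst[symmetric]) simp_all
  also have "\<dots> = (\<integral>\<^sup>+(x, y1, y2, y3). h (y1, y2, y3, x) \<partial>(L \<Otimes>\<^sub>M (M1 \<Otimes>\<^sub>M (M2 \<Otimes>\<^sub>M M3))))"
    unfolding case_prod_unfold by (subst M123.nn_integral_fst[symmetric]) simp_all
  finally show ?thesis .
qed

lemma pair_measure_move_last_outward:
  assumes sf: "sigma_finite_measure M1" "sigma_finite_measure M2" "sigma_finite_measure M3"
    "sigma_finite_measure L"
  shows "M1 \<Otimes>\<^sub>M (M2 \<Otimes>\<^sub>M (M3 \<Otimes>\<^sub>M L)) =
    distr (L \<Otimes>\<^sub>M (M1 \<Otimes>\<^sub>M (M2 \<Otimes>\<^sub>M M3))) (M1 \<Otimes>\<^sub>M (M2 \<Otimes>\<^sub>M (M3 \<Otimes>\<^sub>M L)))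
      (\<lambda>(x, y1, y2, y3). (y1, y2, y3, x))" (is "?C = distr ?R ?C ?\<pi>")
proof (rule measure_eqI)
  have \<pi> [measurable]: "?\<pi> \<in> measurable ?R ?C" by measurable
  fix A assume A: "A \<in> sets ?C"
  have "emeasure ?C A = (\<integral>\<^sup>+q. indicator A q \<partial>?C)" using A by simp
  also have "\<dots> = (\<integral>\<^sup>+(x, y1, y2, y3). indicator A (y1, y2, y3, x) \<partial>?R)"
    by (rule nn_integral_move_last_outward[OF sf]) (use A in measurable)
  also have "\<dots> = (\<integral>\<^sup>+q. indicator A (?\<pi> q) \<partial>?R)"
    by (simp add: case_prod_unfold)
  also have "\<dots> = emeasure (distr ?R ?C ?\<pi>) A"
    using A by (subst nn_integral_distr[OF \<pi>, symmetric]) auto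
  finally show "emeasure ?C A = emeasure (distr ?R ?C ?\<pi>) A" .
qed simp

section \<open>The parametrised knot and its unit tangent field\<close>

locale parametrised_knot =
  fixes f :: "complex \<Rightarrow> real^3"
  assumes f: "knot_param f"
begin

lemma knot_curve_eq_iff:
  "knot_curve f s = knot_curve f t \<longleftrightarrow> (\<exists>n::int. s = t + n * (2 * pi))"
proof -
  have "knot_curve f s = knot_curve f t \<longleftrightarrow> cis s = cis t"
    using f unfolding knot_param_def knot_curve_def by (auto dest: inj_onD)
  also have "\<dots> \<longleftrightarrow> cis (s - t) = 1"
    by (simp flip: cis_divide)
  also have "\<dots> \<longleftrightarrow> cos (s - t) = 1"
    by (auto simp: complex_eq_iff cos_one_sin_zero)
  also have "\<dots> \<longleftrightarrow> (\<exists>n::int. s = t + n * (2 * pi))"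
    by (auto simp: cos_one_2pi_int algebra_simps)
  finally show ?thesis .
qed

lemma obtain_angle:
  obtains s :: real and n :: int where "s \<in> {0..<2*pi}" "t = s + n * (2 * pi)"
proof
  define n where "n = \<lfloor>t / (2 * pi)\<rfloor>"
  have "n \<le> t / (2 * pi)" "t / (2 * pi) < n + 1" unfolding n_def by linarith+
  then have "n * (2 * pi) \<le> t" "t < (n + 1) * (2 * pi)"
    by (simp_all add: field_simps)
  then show "t - n * (2 * pi) \<in> {0..<2*pi}" by (simp add: algebra_simps)
qed simp

lemma knot_curve_in_knot [simp]: "knot_curve f t \<in> knot f"
  by (simp add: knot_curve_def knot_def)

lemma knot_eq_image: "knot f = knot_curve f ` {0..<2*pi}"
proof (intro equalityI subsetI)
  fix y assume "y \<in> knot f"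
  then obtain z where z: "norm z = 1" "y = f z" by (auto simp: knot_def)
  then have "cis (Arg z) = z" using cis_Arg[of z] by (force simp add: sgn_eq)
  moreover obtain s and n :: int where "s \<in> {0..<2*pi}" "Arg z = s + n * (2 * pi)"
    by (rule obtain_angle)
  ultimately show "y \<in> knot_curve f ` {0..<2*pi}"
    using z knot_curve_eq_iff[of "Arg z" s] by (auto simp: knot_curve_def)
qed auto

lemma knot_curve_has_velocity: "(knot_curve f has_vector_derivative velocity f t) (at t)"
  using f unfolding knot_param_def velocity_def C1_differentiable_on_eq
  by (simp add: vector_derivative_works)

lemma velocity_nonzero: "velocity f t \<noteq> 0"
  using f by (simp add: knot_param_def)

lemma continuous_on_velocity: "continuous_on S (velocity f)"
  using f unfolding knot_param_def velocity_def [abs_def] C1_differentiable_on_eq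
  by (blast intro: continuous_on_subset)

lemma continuous_on_knot_curve: "continuous_on S (knot_curve f)"
  using f C1_differentiable_imp_continuous_on continuous_on_subset
  unfolding knot_param_def by blast

lemma velocity_periodic: "velocity f (t + n * (2 * pi)) = velocity f t" for n :: int
proof -
  have "(knot_curve f \<circ> (\<lambda>t. t + n * (2 * pi)) has_vector_derivative
      1 *\<^sub>R velocity f (t + n * (2 * pi))) (at t)"
    by (rule vector_diff_chain_at) (auto intro!: derivative_eq_intros knot_curve_has_velocity)
  moreover have "knot_curve f \<circ> (\<lambda>t. t + n * (2 * pi)) = knot_curve f"
    by (auto simp: knot_curve_eq_iff)
  ultimately show ?thesis
    using vector_derivative_unique_at[OF knot_curve_has_velocity] by simp
qed

text \<open>The unit tangent is defined through the parameter in \<open>[0, 2\<pi>)\<close>; injectivity of \<open>f\<close> on the circle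
  determines this parameter, and periodicity of the velocity extends the formula to all \<open>t\<close>.\<close>

lemma unit_tangent_knot_curve:
  "unit_tangent f (knot_curve f t) = velocity f t /\<^sub>R norm (velocity f t)"
proof -
  obtain s and n :: int where s: "s \<in> {0..<2*pi}" "t = s + n * (2 * pi)"
    by (rule obtain_angle)
  have "(THE s. s \<in> {0..<2*pi} \<and> knot_curve f s = knot_curve f t) = s"
  proof (rule the_equality)
    fix r assume r: "r \<in> {0..<2*pi} \<and> knot_curve f r = knot_curve f t"
    then obtain m :: int where m: "r = t + m * (2 * pi)" by (auto simp: knot_curve_eq_iff)
    have "\<bar>r - s\<bar> < 2 * pi" using r s by auto
    moreover have "r - s = (m + n) * (2 * pi)" using m s by (simp add: algebra_simps)
    ultimately have "\<bar>of_int (m + n)\<bar> < (1::real)" by (simp add: abs_mult)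
    then have "m + n = 0" by linarith
    then show "r = s" using \<open>r - s = _\<close> by simp
  qed (use s knot_curve_eq_iff[of s t] in \<open>auto intro: exI[of _ "- n"]\<close>)
  then show ?thesis
    unfolding unit_tangent_def using s velocity_periodic[of s n] by simp
qed

lemma norm_unit_tangent [simp]: "norm (unit_tangent f y) = 1"
  using velocity_nonzero by (simp add: unit_tangent_def Let_def)

lemma compact_curve_image:
  assumes "closed S" shows "compact (knot_curve f ` ({0..2*pi} \<inter> S))"
  using assms by (intro compact_continuous_image continuous_on_knot_curve compact_Int_closed) auto

text \<open>The parameter itself jumps at \<open>2\<pi>\<close>, so continuity is proved without inverting the curve: the
  preimage of a closed set is the image of a compact set of parameters.\<close>

lemma continuous_on_unit_tangent: "continuous_on (knot f) (unit_tangent f)"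
  unfolding continuous_on_closed_vimage[OF compact_imp_closed[OF compact_knot[OF f]]]
proof (intro allI impI)
  fix B :: "(real^3) set" assume "closed B"
  let ?T = "\<lambda>t. velocity f t /\<^sub>R norm (velocity f t)"
  have "continuous_on UNIV ?T"
    by (intro continuous_intros continuous_on_velocity) (simp add: velocity_nonzero)
  then have "closed (?T -` B)" using \<open>closed B\<close> by (rule closed_vimage[rotated])
  moreover have "unit_tangent f -` B \<inter> knot f = knot_curve f ` ({0..2*pi} \<inter> ?T -` B)"
  proof -
    have preimage: "u -` B \<inter> c ` S = c ` (S \<inter> (\<lambda>t. u (c t)) -` B)"
      for u :: "real^3 \<Rightarrow> real^3" and c :: "real \<Rightarrow> real^3" and S by auto
    have "knot f = knot_curve f ` {0..2*pi}"
    proof (rule antisym)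
      show "knot f \<subseteq> knot_curve f ` {0..2*pi}"
        unfolding knot_eq_image by (rule image_mono) auto
    qed auto
    then show ?thesis by (simp only: preimage unit_tangent_knot_curve)
  qed
  ultimately show "closed (unit_tangent f -` B \<inter> knot f)"
    using compact_imp_closed[OF compact_curve_image] by simp
qed

lemma knot_borel [measurable]: "knot f \<in> sets borel"
  using compact_knot[OF f] by (intro borel_closed compact_imp_closed)

text \<open>Off the knot the definite description in \<open>unit_tangent\<close> has no witness, so that it
  denotes the same parameter for all such points and the tangent field is constant there.\<close>

lemma measurable_unit_tangent [measurable]: "unit_tangent f \<in> borel_measurable borel"
proof -
  define t0 where "t0 = (THE t::real. False)"
  define c where "c = velocity f t0 /\<^sub>R norm (velocity f t0)"
  have off: "unit_tangent f y = c" if "y \<notin> knot f" for y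
  proof -
    have "knot_curve f t \<noteq> y" for t using that by auto
    then show ?thesis by (simp add: unit_tangent_def c_def t0_def Let_def)
  qed
  have [measurable]: "(\<lambda>y. indicator (knot f) y *\<^sub>R unit_tangent f y) \<in> borel_measurable borel"
    by (intro borel_measurable_continuous_on_indicator continuous_on_unit_tangent) measurable
  have "unit_tangent f = (\<lambda>y. if y \<in> knot f then indicator (knot f) y *\<^sub>R unit_tangent f y else c)"
    by (auto simp: off)
  also have "\<dots> \<in> borel_measurable borel" by measurable
  finally show ?thesis .
qed

lemma measurable_tangent_form [measurable]:
  "case_prod (tangent_form f) \<in> borel_measurable (borel \<Otimes>\<^sub>M borel)"
  unfolding tangent_form_def vtilde_def vhat_def by measurable

lemma measurable_tangent_form_compose [measurable]:
  assumes [measurable]: "X \<in> borel_measurable M" "Y \<in> borel_measurable M"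
  shows "(\<lambda>q. tangent_form f (X q) (Y q)) \<in> borel_measurable M"
  using measurable_compose[OF _ measurable_tangent_form, of "\<lambda>q. (X q, Y q)"] by simp

lemma norm_tangent_form_le: "norm (tangent_form f x y) \<le> 3 / (norm (x - y))\<^sup>2"
proof -
  have "norm (vhat y (unit_tangent f y) x) \<le> 3" using norm_vhat_le[of y "unit_tangent f y" x] by simp
  then show ?thesis
    by (simp add: tangent_form_def vtilde_def divide_inverse mult.commute mult_right_mono)
qed

section \<open>The cyclic order and the configuration space\<close>

text \<open>On parameters in \<open>[0, 2\<pi>)\<close> the cyclic order consists of the three rotations of the linear order.\<close>

lemma cyc_ordered_iff:
  assumes "s1 \<in> {0..<2*pi}" "s2 \<in> {0..<2*pi}" "s3 \<in> {0..<2*pi}"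
  shows "cyc_ordered f (knot_curve f s1) (knot_curve f s2) (knot_curve f s3) \<longleftrightarrow>
    s1 < s2 \<and> s2 < s3 \<or> s2 < s3 \<and> s3 < s1 \<or> s3 < s1 \<and> s1 < s2"
    (is "?cyc \<longleftrightarrow> ?order")
proof
  assume ?cyc
  then obtain t1 t2 t3 where t: "t1 < t2" "t2 < t3" "t3 < t1 + 2*pi"
      "knot_curve f t1 = knot_curve f s1" "knot_curve f t2 = knot_curve f s2"
      "knot_curve f t3 = knot_curve f s3"
    unfolding cyc_ordered_def by blast
  then obtain n1 n2 n3 :: int where
    n: "t1 = s1 + n1 * (2*pi)" "t2 = s2 + n2 * (2*pi)" "t3 = s3 + n3 * (2*pi)"
    by (auto simp: knot_curve_eq_iff)
  \<comment> \<open>For two angles whose lifts differ by an amount in \<open>(0, 2\<pi>)\<close> the second lift is at most one turn ahead.\<close>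
  have step: "j - i \<in> {0, 1}"
    if "s + i * (2*pi) < r + j * (2*pi)" "r + j * (2*pi) < s + i * (2*pi) + 2*pi"
      "s \<in> {0..<2*pi}" "r \<in> {0..<2*pi}" for s r and i j :: int
  proof -
    have "(j - i) * (2*pi) < 2 * (2*pi)" "(-1) * (2*pi) < (j - i) * (2*pi)"
      using that by (auto simp: algebra_simps)
    then have "of_int (j - i) < (2::real)" "(-1::real) < of_int (j - i)"
      by (simp_all only: mult_less_cancel_right_pos[OF mult_pos_pos[OF zero_less_numeral pi_gt_zero]])
    then show ?thesis by (auto simp del: of_int_diff)
  qed
  have "n2 - n1 \<in> {0, 1}" "n3 - n1 \<in> {0, 1}" "n3 - n2 \<in> {0, 1}"
    using step[of s1 n1 s2 n2] step[of s1 n1 s3 n3] step[of s2 n2 s3 n3] t(1-3) assms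
    unfolding n by linarith+
  then consider "n2 = n1" "n3 = n1" | "n2 = n1" "n3 = n1 + 1" | "n2 = n1 + 1" "n3 = n1 + 1"
    by force
  then show ?order
    using t(1-3) assms unfolding n by cases (auto simp: algebra_simps)
next
  have per: "knot_curve f (s + 2*pi) = knot_curve f s" for s
    using knot_curve_eq_iff by (metis mult_1 of_int_1)
  assume ?order
  then consider "s1 < s2" "s2 < s3" | "s2 < s3" "s3 < s1" | "s3 < s1" "s1 < s2" by blast
  then show ?cyc
  proof cases
    case 1 then show ?thesis
      unfolding cyc_ordered_def using assms by (intro exI[of _ s1] exI[of _ s2] exI[of _ s3]) auto
  next
    case 2 then show ?thesis
      unfolding cyc_ordered_def using assms
      by (intro exI[of _ s1] exI[of _ "s2 + 2*pi"] exI[of _ "s3 + 2*pi"]) (auto simp: per)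
  next
    case 3 then show ?thesis
      unfolding cyc_ordered_def using assms
      by (intro exI[of _ s1] exI[of _ s2] exI[of _ "s3 + 2*pi"]) (auto simp: per)
  qed
qed

text \<open>The admissible parameter triples form an open set, hence a countable union of compact sets, and
  continuous images of these are compact. Thus the set is \<open>F\<^sub>\<sigma>\<close>.\<close>

lemma cyc_ordered_borel: "{(y1, y2, y3). cyc_ordered f y1 y2 y3} \<in> sets borel"
proof -
  define S where "S = {(t1, t2, t3). t1 < t2 \<and> t2 < t3 \<and> t3 < t1 + 2*pi}"
  define g where "g = (\<lambda>(t1, t2, t3). (knot_curve f t1, knot_curve f t2, knot_curve f t3))"
  have "S = {t. fst t < fst (snd t)} \<inter> {t. fst (snd t) < snd (snd t)} \<inter>
      {t. snd (snd t) < fst t + 2*pi}"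
    by (auto simp: S_def)
  then have "open S"
    by (auto intro!: open_Int open_Collect_less continuous_intros)
  then obtain C :: "nat \<Rightarrow> (real \<times> real \<times> real) set"
    where C: "\<And>n. compact (C n)" "(\<Union>n. C n) = S"
    by (metis open_Union_compact_subsets)
  have "continuous_on UNIV g"
    unfolding g_def case_prod_unfold
    by (intro continuous_on_Pair continuous_on_compose2[OF continuous_on_knot_curve[of UNIV]]
        continuous_intros) auto
  then have "compact (g ` C n)" for n
    using C(1) by (meson compact_continuous_image continuous_on_subset subset_UNIV)
  then have "(\<Union>n. g ` C n) \<in> sets borel"
    by (intro sets.countable_UN) (auto intro: borel_closed compact_imp_closed)
  also have "(\<Union>n. g ` C n) = g ` S"
    using C(2) by blast
  also have "\<dots> = {(y1, y2, y3). cyc_ordered f y1 y2 y3}"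
    unfolding cyc_ordered_def S_def g_def by (auto simp: image_iff) blast
  finally show ?thesis .
qed

lemma measurable_cyc_ordered [measurable]:
  assumes [measurable]: "X \<in> borel_measurable M" "Y \<in> borel_measurable M" "Z \<in> borel_measurable M"
  shows "Measurable.pred M (\<lambda>q. cyc_ordered f (X q) (Y q) (Z q))"
proof -
  have p: "(\<lambda>q. (X q, Y q, Z q)) \<in> borel_measurable M" by (simp add: borel_prod [symmetric])
  have c: "Measurable.pred borel (\<lambda>(y1, y2, y3). cyc_ordered f y1 y2 y3)"
    unfolding pred_def using cyc_ordered_borel by (simp add: case_prod_unfold)
  show ?thesis
    using measurable_compose[OF p c] by simp
qed

text \<open>Cyclically ordered points lie on the knot and are pairwise distinct, so all conditions on the
  \<open>y\<^sub>i\<close> reduce to the cyclic order.\<close>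

lemma UY_iff: "(y1, y2, y3, x) \<in> UY f \<longleftrightarrow> cyc_ordered f y1 y2 y3 \<and> x \<notin> knot f"
proof -
  have "y1 \<in> knot f \<and> y2 \<in> knot f \<and> y3 \<in> knot f \<and> y1 \<noteq> y2 \<and> y1 \<noteq> y3 \<and> y2 \<noteq> y3"
    if "cyc_ordered f y1 y2 y3"
  proof -
    have "y1 \<in> knot f" "y2 \<in> knot f" "y3 \<in> knot f"
      using that knot_curve_in_knot by (auto simp: cyc_ordered_def)
    moreover from this obtain s1 s2 s3 where s: "s1 \<in> {0..<2*pi}" "s2 \<in> {0..<2*pi}" "s3 \<in> {0..<2*pi}"
      "y1 = knot_curve f s1" "y2 = knot_curve f s2" "y3 = knot_curve f s3"
      unfolding knot_eq_image by blast
    moreover have "y1 \<noteq> y2" "y1 \<noteq> y3" "y2 \<noteq> y3"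
      using that cyc_ordered_iff[OF s(1,1,3)] cyc_ordered_iff[OF s(1,2,1)] cyc_ordered_iff[OF s(1,2,2)] s
      by auto
    ultimately show ?thesis by blast
  qed
  then show ?thesis by (auto simp: UY_def)
qed

section \<open>The arc-length measure\<close>

lemma sets_arc_length [simp, measurable_cong]: "sets (arc_length f) = sets borel"
  by (simp add: arc_length_def)

lemma space_arc_length [simp]: "space (arc_length f) = UNIV"
  by (simp add: arc_length_def)

lemma borel_measurable_velocity [measurable]: "velocity f \<in> borel_measurable borel"
  by (intro borel_measurable_continuous_onI continuous_on_velocity)

lemma borel_measurable_knot_curve [measurable]: "knot_curve f \<in> borel_measurable borel"
  by (intro borel_measurable_continuous_onI continuous_on_knot_curve)

lemma measurable_knot_curve_restrict:
  "knot_curve f \<in> measurable (density (restrict_space lborel {0..<2*pi}) g) borel"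
  by (simp add: measurable_restrict_space1)

lemma AE_arc_length: "AE y in arc_length f. y \<in> knot f"
  unfolding arc_length_def
  by (subst AE_distr_iff[OF measurable_knot_curve_restrict])
     (simp_all add: knot_curve_in_knot knot_borel)

lemma integral_arc_length:
  fixes g :: "real^3 \<Rightarrow> 'a :: {banach, second_countable_topology}"
  assumes [measurable]: "g \<in> borel_measurable borel"
  shows "(\<integral>y. g y \<partial>arc_length f) =
    (\<integral>t. indicator {0..<2*pi} t *\<^sub>R norm (velocity f t) *\<^sub>R g (knot_curve f t) \<partial>lborel)"
proof -
  have m: "(\<lambda>t. g (knot_curve f t)) \<in> borel_measurable (restrict_space lborel {0..<2*pi})"
    "(\<lambda>t. norm (velocity f t)) \<in> borel_measurable (restrict_space lborel {0..<2*pi})"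
    by (simp_all add: measurable_restrict_space1)
  show ?thesis
    unfolding arc_length_def
    by (subst integral_distr[OF measurable_knot_curve_restrict assms])
       (simp add: integral_density[OF m(1) m(2)] integral_restrict_space)
qed

text \<open>The speed is bounded on a period, so the knot has finite length.\<close>

lemma finite_arc_length: "finite_measure (arc_length f)"
proof
  have "bounded (velocity f ` {0..2*pi})"
    by (intro compact_imp_bounded compact_continuous_image continuous_on_velocity) auto
  then obtain B where B: "\<And>t. t \<in> {0..2*pi} \<Longrightarrow> norm (velocity f t) \<le> B"
    unfolding bounded_iff by blast
  let ?R = "restrict_space lborel {0..<2*pi}"
  have "emeasure (arc_length f) UNIV =
      emeasure (density ?R (\<lambda>t. ennreal (norm (velocity f t)))) (space ?R)"
    unfolding arc_length_def by (subst emeasure_distr[OF measurable_knot_curve_restrict]) simp_all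
  also have "\<dots> = (\<integral>\<^sup>+t. ennreal (norm (velocity f t)) \<partial>?R)"
    by (subst emeasure_density) (auto intro!: nn_integral_cong simp: measurable_restrict_space1 sets_restrict_space_iff)
  also have "\<dots> = (\<integral>\<^sup>+t. ennreal (norm (velocity f t)) * indicator {0..<2*pi} t \<partial>lborel)"
    by (simp add: nn_integral_restrict_space)
  also have "\<dots> \<le> (\<integral>\<^sup>+t. ennreal B * indicator {0..<2*pi} t \<partial>lborel)"
    by (intro nn_integral_mono) (auto intro!: ennreal_leI B split: split_indicator)
  also have "\<dots> < \<infinity>"
    by (simp add: nn_integral_cmult_indicator ennreal_mult_less_top)
  finally show "emeasure (arc_length f) (space (arc_length f)) \<noteq> \<infinity>" by simp
qed

text \<open>The measure is concentrated on the knot, so a bound there is enough; \<open>tangent_form f x\<close> and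
  \<open>inversion x\<close> have one there, though they are unbounded near \<open>x\<close>.\<close>

lemma integrable_arc_length:
  fixes g :: "real^3 \<Rightarrow> 'a :: {banach, second_countable_topology}"
  assumes "g \<in> borel_measurable borel" "\<And>y. y \<in> knot f \<Longrightarrow> norm (g y) \<le> B"
  shows "integrable (arc_length f) g"
proof -
  interpret finite_measure "arc_length f" by (rule finite_arc_length)
  show ?thesis
    by (rule integrable_const_bound[of _ B]) (use AE_arc_length assms in \<open>auto elim: eventually_mono\<close>)
qed

section \<open>The tangent form integrated over arcs of the knot\<close>

context
  fixes x :: "real^3"
  assumes x: "x \<notin> knot f"
begin

lemma knot_curve_neq: "knot_curve f t \<noteq> x"
  using knot_curve_in_knot[of t] x by auto

lemma speed_tangent_form:
  "norm (velocity f t) *\<^sub>R tangent_form f x (knot_curve f t) = vtilde (knot_curve f t) (velocity f t) x"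
  using velocity_nonzero[of t]
  by (simp add: tangent_form_def unit_tangent_knot_curve vtilde_scale)

text \<open>The speed in the arc-length element cancels the normalisation of the unit tangent, which leaves
  minus the derivative of the inverted curve.\<close>

lemma has_integral_arc:
  assumes "a \<le> b"
  shows "has_bochner_integral lborel
    (\<lambda>t. indicator {a..b} t *\<^sub>R norm (velocity f t) *\<^sub>R tangent_form f x (knot_curve f t))
    (inversion x (knot_curve f a) - inversion x (knot_curve f b))"
proof -
  have "continuous_on {a..b} (\<lambda>t. - vtilde (knot_curve f t) (velocity f t) x)"
    unfolding vtilde_def vhat_def
    by (intro continuous_intros continuous_on_knot_curve continuous_on_velocity)
       (use knot_curve_neq in auto)
  moreover have "((\<lambda>t. inversion x (knot_curve f t)) has_vector_derivative
      - vtilde (knot_curve f t) (velocity f t) x) (at t within {a..b})" for t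
    using inversion_curve_derivative[OF knot_curve_has_velocity knot_curve_neq]
    by (rule has_vector_derivative_at_within)
  ultimately have "has_bochner_integral lborel
      (\<lambda>t. indicator {a..b} t *\<^sub>R - vtilde (knot_curve f t) (velocity f t) x)
      (inversion x (knot_curve f b) - inversion x (knot_curve f a))"
    using assms by (intro has_bochner_integral_FTC_Icc) auto
  from has_bochner_integral_minus[OF this] show ?thesis
    by (simp add: speed_tangent_form)
qed

lemma measurable_tangent_form1 [measurable]: "tangent_form f x \<in> borel_measurable borel"
  by (intro measurable_tangent_form_compose) auto

text \<open>The inverted knot is a closed curve.\<close>

lemma integral_tangent_form: "(\<integral>y. tangent_form f x y \<partial>arc_length f) = 0"
proof -
  have "(\<integral>y. tangent_form f x y \<partial>arc_length f) =
      (\<integral>t. indicator {0..<2*pi} t *\<^sub>R norm (velocity f t) *\<^sub>R tangent_form f x (knot_curve f t) \<partial>lborel)"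
    by (rule integral_arc_length) simp
  also have "\<dots> = (\<integral>t. indicator {0..2*pi} t *\<^sub>R norm (velocity f t) *\<^sub>R tangent_form f x (knot_curve f t) \<partial>lborel)"
    using AE_lborel_singleton[of "2*pi"]
    by (intro integral_cong_AE) (auto elim!: eventually_mono split: split_indicator)
  also have "\<dots> = inversion x (knot_curve f 0) - inversion x (knot_curve f (2*pi))"
    by (intro has_bochner_integral_integral_eq has_integral_arc) simp
  also have "knot_curve f (2*pi) = knot_curve f 0"
    by (simp add: knot_curve_def)
  finally show ?thesis by simp
qed

text \<open>The points \<open>y\<^sub>3\<close> with \<open>y\<^sub>1 \<prec> y\<^sub>2 \<prec> y\<^sub>3\<close> form the open arc from \<open>y\<^sub>2\<close> to \<open>y\<^sub>1\<close>. If this arc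
  runs through the point of parameter \<open>0\<close>, it is cut into two pieces, whose contributions at \<open>0\<close> and \<open>2\<pi>\<close>
  cancel. For \<open>y\<^sub>1 = y\<^sub>2\<close> both sides are \<open>0\<close>.\<close>

lemma integral_tangent_form_arc:
  assumes "y1 \<in> knot f" "y2 \<in> knot f"
  shows "(\<integral>y3. indicator {y3. cyc_ordered f y1 y2 y3} y3 *\<^sub>R tangent_form f x y3 \<partial>arc_length f) =
    inversion x y2 - inversion x y1"
proof -
  obtain s1 s2 where s: "s1 \<in> {0..<2*pi}" "s2 \<in> {0..<2*pi}"
      "y1 = knot_curve f s1" "y2 = knot_curve f s2"
    using assms unfolding knot_eq_image by blast
  define h where "h t = norm (velocity f t) *\<^sub>R tangent_form f x (knot_curve f t)" for t
  have [measurable]: "h \<in> borel_measurable borel" unfolding h_def by measurable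
  have arc: "has_bochner_integral lborel (\<lambda>t. indicator {a..b} t *\<^sub>R h t)
      (inversion x (knot_curve f a) - inversion x (knot_curve f b))" if "a \<le> b" for a b
    using has_integral_arc[OF that] by (simp add: h_def)
  have eq: "indicator {0..<2*pi} t *\<^sub>R norm (velocity f t) *\<^sub>R
        (indicator {y3. cyc_ordered f y1 y2 y3} (knot_curve f t) *\<^sub>R tangent_form f x (knot_curve f t)) =
      indicator {t \<in> {0..<2*pi}. s1 < s2 \<and> s2 < t \<or> s2 < t \<and> t < s1 \<or> t < s1 \<and> s1 < s2} t *\<^sub>R h t" for t
    using cyc_ordered_iff[OF s(1,2), of t] by (auto simp: h_def s split: split_indicator)
  have "(\<integral>y3. indicator {y3. cyc_ordered f y1 y2 y3} y3 *\<^sub>R tangent_form f x y3 \<partial>arc_length f) =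
      (\<integral>t. indicator {t \<in> {0..<2*pi}. s1 < s2 \<and> s2 < t \<or> s2 < t \<and> t < s1 \<or> t < s1 \<and> s1 < s2} t *\<^sub>R h t \<partial>lborel)"
    unfolding eq[symmetric] by (rule integral_arc_length) measurable
  also have "\<dots> = inversion x y2 - inversion x y1"
  proof (cases s1 s2 rule: linorder_cases)
    case less
    have "(\<integral>t. indicator {t \<in> {0..<2*pi}. s1 < s2 \<and> s2 < t \<or> s2 < t \<and> t < s1 \<or> t < s1 \<and> s1 < s2} t *\<^sub>R h t \<partial>lborel) =
        (\<integral>t. indicator {0..s1} t *\<^sub>R h t + indicator {s2..2*pi} t *\<^sub>R h t \<partial>lborel)"
      using less s AE_lborel_singleton[of s1] AE_lborel_singleton[of s2] AE_lborel_singleton[of "2*pi"]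
      by (intro integral_cong_AE) (auto elim!: eventually_elim2 split: split_indicator)
    also have "\<dots> = (inversion x (knot_curve f 0) - inversion x y1) +
        (inversion x y2 - inversion x (knot_curve f (2*pi)))"
      unfolding s using less s
      by (intro has_bochner_integral_integral_eq has_bochner_integral_add arc) auto
    also have "knot_curve f (2*pi) = knot_curve f 0"
      by (simp add: knot_curve_def)
    finally show ?thesis by simp
  next
    case equal
    then show ?thesis by (simp add: s cong: conj_cong disj_cong)
  next
    case greater
    have "(\<integral>t. indicator {t \<in> {0..<2*pi}. s1 < s2 \<and> s2 < t \<or> s2 < t \<and> t < s1 \<or> t < s1 \<and> s1 < s2} t *\<^sub>R h t \<partial>lborel) =
        (\<integral>t. indicator {s2..s1} t *\<^sub>R h t \<partial>lborel)"
      using greater s AE_lborel_singleton[of s1] AE_lborel_singleton[of s2]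
      by (intro integral_cong_AE) (auto elim!: eventually_elim2 split: split_indicator)
    also have "\<dots> = inversion x y2 - inversion x y1"
      unfolding s using greater by (intro has_bochner_integral_integral_eq arc) auto
    finally show ?thesis .
  qed
  finally show ?thesis .
qed

end

section \<open>The integral over the points of the knot\<close>

lemma infdist_le_dist: "y \<in> knot f \<Longrightarrow> infdist x (knot f) \<le> norm (x - y)"
  using infdist_le[of y "knot f" x] by (simp add: dist_norm)

lemma infdist_knot_pos: "x \<notin> knot f \<Longrightarrow> infdist x (knot f) > 0"
  using compact_imp_closed[OF compact_knot[OF f]]
  by (intro infdist_pos_not_in_closed) (auto simp: knot_eq_image)

lemma cyc_ordered_in_knot:
  assumes "cyc_ordered f y1 y2 y3"
  shows "y1 \<in> knot f" "y2 \<in> knot f" "y3 \<in> knot f"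
  using assms knot_curve_in_knot by (auto simp: cyc_ordered_def)

lemma borel_measurable_wedge_density [measurable]:
  assumes [measurable]: "X \<in> borel_measurable M" "Y1 \<in> borel_measurable M" "Y2 \<in> borel_measurable M"
    "Y3 \<in> borel_measurable M"
  shows "(\<lambda>q. wedge_density f (Y1 q, Y2 q, Y3 q, X q)) \<in> borel_measurable M"
  unfolding wedge_density_triple by measurable

lemma norm_tangent_form_le_of_dist:
  assumes "\<delta> > 0" "\<delta> \<le> norm (x - y)"
  shows "norm (tangent_form f x y) \<le> 3 / \<delta>\<^sup>2"
proof -
  have "\<delta>\<^sup>2 \<le> (norm (x - y))\<^sup>2" using assms by (intro power_mono) auto
  then have "3 / (norm (x - y))\<^sup>2 \<le> 3 / \<delta>\<^sup>2"
    using assms by (intro divide_left_mono) (auto intro!: mult_pos_pos)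
  then show ?thesis using norm_tangent_form_le order_trans by blast
qed

lemma wedge_density_le:
  assumes "\<delta> > 0" "\<delta> \<le> norm (x - y1)" "\<delta> \<le> norm (x - y2)" "\<delta> \<le> norm (x - y3)"
  shows "\<bar>wedge_density f (y1, y2, y3, x)\<bar> \<le> (3 / \<delta>\<^sup>2) ^ 3"
proof -
  have "norm (tangent_form f x y1) * norm (tangent_form f x y2) * norm (tangent_form f x y3)
      \<le> (3 / \<delta>\<^sup>2) * (3 / \<delta>\<^sup>2) * (3 / \<delta>\<^sup>2)"
    using assms norm_tangent_form_le_of_dist by (intro mult_mono) auto
  then show ?thesis
    unfolding wedge_density_triple by (intro order_trans[OF triple_le]) (simp add: power3_eq_cube)
qed

context
  fixes x :: "real^3"
  assumes x: "x \<notin> knot f"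
begin

interpretation arc: finite_measure "arc_length f" by (rule finite_arc_length)
interpretation arc2: finite_measure "arc_length f \<Otimes>\<^sub>M arc_length f"
  by (intro finite_measure_pair_measure arc.finite_measure_axioms)
interpretation arc3: finite_measure "arc_length f \<Otimes>\<^sub>M (arc_length f \<Otimes>\<^sub>M arc_length f)"
  by (intro finite_measure_pair_measure arc.finite_measure_axioms arc2.finite_measure_axioms)
interpretation P2: pair_sigma_finite "arc_length f" "arc_length f" ..
interpretation P3: pair_sigma_finite "arc_length f" "arc_length f \<Otimes>\<^sub>M arc_length f" ..

definition cyc_density :: "real^3 \<Rightarrow> real^3 \<Rightarrow> real^3 \<Rightarrow> real" where
  "cyc_density y1 y2 y3 = (if cyc_ordered f y1 y2 y3 then wedge_density f (y1, y2, y3, x) else 0)"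

lemma abs_cyc_density_le: "\<bar>cyc_density y1 y2 y3\<bar> \<le> (3 / (infdist x (knot f))\<^sup>2) ^ 3"
  using wedge_density_le[OF infdist_knot_pos[OF x]] infdist_le_dist cyc_ordered_in_knot[of y1 y2 y3]
  by (auto simp: cyc_density_def)

lemma measurable_cyc_density [measurable]:
  assumes [measurable]: "Y1 \<in> borel_measurable M" "Y2 \<in> borel_measurable M" "Y3 \<in> borel_measurable M"
  shows "(\<lambda>q. cyc_density (Y1 q) (Y2 q) (Y3 q)) \<in> borel_measurable M"
  unfolding cyc_density_def by measurable

lemma integrable_cyc_density:
  "integrable (arc_length f \<Otimes>\<^sub>M (arc_length f \<Otimes>\<^sub>M arc_length f)) (\<lambda>(y1, y2, y3). cyc_density y1 y2 y3)"
  by (rule arc3.integrable_const_bound[of _ "(3 / (infdist x (knot f))\<^sup>2) ^ 3"])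
     (use abs_cyc_density_le in \<open>auto simp: case_prod_unfold\<close>)

lemma norm_tangent_form_le_on_knot:
  "y \<in> knot f \<Longrightarrow> norm (tangent_form f x y) \<le> 3 / (infdist x (knot f))\<^sup>2"
  by (intro norm_tangent_form_le_of_dist infdist_knot_pos[OF x] infdist_le_dist)

lemma integral_cyc_density_last:
  assumes "y1 \<in> knot f" "y2 \<in> knot f"
  shows "(\<integral>y3. cyc_density y1 y2 y3 \<partial>arc_length f) =
    tangent_form f x y1 \<bullet> (tangent_form f x y2 \<times> (inversion x y2 - inversion x y1))"
proof -
  have dual: "a \<bullet> (b \<times> c) = (a \<times> b) \<bullet> c" for a b c :: "real^3"
    by (simp add: cross3_simps)
  have int: "integrable (arc_length f)
      (\<lambda>y3. indicator {y3. cyc_ordered f y1 y2 y3} y3 *\<^sub>R tangent_form f x y3)"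
    by (intro integrable_arc_length[of _ "3 / (infdist x (knot f))\<^sup>2"])
       (auto intro: norm_tangent_form_le_on_knot split: split_indicator)
  have "(\<integral>y3. cyc_density y1 y2 y3 \<partial>arc_length f) =
      (\<integral>y3. (tangent_form f x y1 \<times> tangent_form f x y2) \<bullet>
        (indicator {y3. cyc_ordered f y1 y2 y3} y3 *\<^sub>R tangent_form f x y3) \<partial>arc_length f)"
    by (intro Bochner_Integration.integral_cong)
       (auto simp: cyc_density_def wedge_density_triple dual split: split_indicator)
  also have "\<dots> = (tangent_form f x y1 \<times> tangent_form f x y2) \<bullet> (inversion x y2 - inversion x y1)"
    by (simp only: integral_inner_right[OF int] integral_tangent_form_arc[OF x assms])
  finally show ?thesis by (simp only: dual)
qed

text \<open>Both remaining integrations use that \<open>tangent_form f x\<close> has integral \<open>0\<close> over the knot: in the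
  integral over \<open>y\<^sub>2\<close> it removes the dependence of the second factor on \<open>y\<^sub>1\<close>, and in the integral
  over \<open>y\<^sub>1\<close> it annihilates what is left, the scalar product with the constant vector
  \<open>\<integral> tangent_form f x y \<times> inversion x y dy\<close>.\<close>

lemma integral_cyc_density:
  "(\<integral>(y1, y2, y3). cyc_density y1 y2 y3 \<partial>(arc_length f \<Otimes>\<^sub>M (arc_length f \<Otimes>\<^sub>M arc_length f))) = 0"
proof -
  let ?k = "tangent_form f x" and ?C = "inversion x" and ?\<mu> = "arc_length f"
  have boundC: "norm (?C y) \<le> 1 / infdist x (knot f)" if "y \<in> knot f" for y
    using infdist_le_dist[OF that, of x] infdist_knot_pos[OF x]
    by (auto simp: inversion_def divide_simps power2_eq_square norm_minus_commute)
  have [measurable]: "?C \<in> borel_measurable borel" unfolding inversion_def [abs_def] by measurable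
  have k: "integrable ?\<mu> ?k"
    by (rule integrable_arc_length[OF _ norm_tangent_form_le_on_knot]) auto
  have kC: "integrable ?\<mu> (\<lambda>y. ?k y \<times> ?C y)"
  proof (rule integrable_arc_length)
    show "norm (?k y \<times> ?C y) \<le> 3 / (infdist x (knot f))\<^sup>2 * (1 / infdist x (knot f))"
      if "y \<in> knot f" for y
      using norm_tangent_form_le_on_knot[OF that] boundC[OF that]
      by (intro order_trans[OF norm_cross_le] mult_mono) auto
  qed measurable
  have k': "integrable ?\<mu> (\<lambda>y. ?k y \<times> c)" "(\<integral>y. ?k y \<times> c \<partial>?\<mu>) = 0" for c
    using integrable_bounded_linear[OF bounded_bilinear.bounded_linear_left[OF bounded_bilinear_cross] k]
      integral_bounded_linear[OF bounded_bilinear.bounded_linear_left[OF bounded_bilinear_cross] k]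
    by (simp_all add: integral_tangent_form[OF x])
  define W where "W = (\<integral>y. ?k y \<times> ?C y \<partial>?\<mu>)"
  have slice: "integrable (?\<mu> \<Otimes>\<^sub>M ?\<mu>) (\<lambda>(y2, y3). cyc_density y1 y2 y3)" for y1
    by (rule arc2.integrable_const_bound[of _ "(3 / (infdist x (knot f))\<^sup>2) ^ 3"])
       (use abs_cyc_density_le in \<open>auto simp: case_prod_unfold\<close>)
  have inner: "(\<integral>(y2, y3). cyc_density y1 y2 y3 \<partial>(?\<mu> \<Otimes>\<^sub>M ?\<mu>)) = ?k y1 \<bullet> W"
    if y1: "y1 \<in> knot f" for y1
  proof -
    have "(\<integral>(y2, y3). cyc_density y1 y2 y3 \<partial>(?\<mu> \<Otimes>\<^sub>M ?\<mu>)) =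
        (\<integral>y2. (\<integral>y3. cyc_density y1 y2 y3 \<partial>?\<mu>) \<partial>?\<mu>)"
      using P2.integral_fst'[OF slice] by simp
    also have "\<dots> = (\<integral>y2. ?k y1 \<bullet> (?k y2 \<times> (?C y2 - ?C y1)) \<partial>?\<mu>)"
    proof (rule integral_cong_AE)
      show "AE y2 in ?\<mu>. (\<integral>y3. cyc_density y1 y2 y3 \<partial>?\<mu>) = ?k y1 \<bullet> (?k y2 \<times> (?C y2 - ?C y1))"
        using AE_arc_length by eventually_elim (rule integral_cyc_density_last[OF y1])
    qed measurable
    also have "\<dots> = (\<integral>y2. ?k y1 \<bullet> (?k y2 \<times> ?C y2) - ?k y1 \<bullet> (?k y2 \<times> ?C y1) \<partial>?\<mu>)"
      by (simp only: Cross3.right_diff_distrib inner_diff_right)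
    also have "\<dots> = ?k y1 \<bullet> W"
      using kC k' by (simp add: W_def)
    finally show ?thesis .
  qed
  have "(\<integral>(y1, y2, y3). cyc_density y1 y2 y3 \<partial>(?\<mu> \<Otimes>\<^sub>M (?\<mu> \<Otimes>\<^sub>M ?\<mu>))) =
      (\<integral>y1. (\<integral>(y2, y3). cyc_density y1 y2 y3 \<partial>(?\<mu> \<Otimes>\<^sub>M ?\<mu>)) \<partial>?\<mu>)"
    using P3.integral_fst'[OF integrable_cyc_density] by simp
  also have "\<dots> = (\<integral>y1. ?k y1 \<bullet> W \<partial>?\<mu>)"
  proof (rule integral_cong_AE)
    show "AE y1 in ?\<mu>. (\<integral>(y2, y3). cyc_density y1 y2 y3 \<partial>(?\<mu> \<Otimes>\<^sub>M ?\<mu>)) = ?k y1 \<bullet> W"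
      using AE_arc_length by eventually_elim (rule inner)
  qed (auto simp: case_prod_unfold)
  also have "\<dots> = 0"
    using k by (simp add: integral_tangent_form[OF x])
  finally show ?thesis .
qed

end

section \<open>Integration over the configuration space\<close>

lemma UY_away_iff:
  "(y1, y2, y3, x) \<in> UY_away f \<delta> \<longleftrightarrow>
    cyc_ordered f y1 y2 y3 \<and> x \<notin> knot f \<and> infdist x (knot f) > \<delta>"
  by (auto simp: UY_away_def UY_iff)

definition away_density :: "real \<Rightarrow> config \<Rightarrow> real" where
  "away_density \<delta> q = indicator (UY_away f \<delta>) q *\<^sub>R wedge_density f q"

lemma away_density_eq:
  "away_density \<delta> (y1, y2, y3, x) =
    (if cyc_ordered f y1 y2 y3 \<and> x \<notin> knot f \<and> infdist x (knot f) > \<delta>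
     then wedge_density f (y1, y2, y3, x) else 0)"
  by (simp add: away_density_def UY_away_iff indicator_def)

lemma borel_measurable_away_density [measurable]: "away_density \<delta> \<in> borel_measurable (config_measure f)"
proof -
  have [measurable]: "(\<lambda>x. infdist x (knot f)) \<in> borel_measurable borel"
    by (intro borel_measurable_continuous_onI continuous_intros)
  have "away_density \<delta> = (\<lambda>(y1, y2, y3, x).
      if cyc_ordered f y1 y2 y3 \<and> x \<notin> knot f \<and> infdist x (knot f) > \<delta>
      then wedge_density f (y1, y2, y3, x) else 0)"
    by (auto simp: away_density_eq)
  also have "\<dots> \<in> borel_measurable (config_measure f)"
    unfolding config_measure_def case_prod_unfold by measurable
  finally show ?thesis .
qed

text \<open>If the knot lies in the ball of radius \<open>R\<close> and \<open>|x - y| \<ge> \<delta>\<close>, then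
  \<open>1 + |x| \<le> |x - y| + (1 + R) \<le> (1 + (1 + R)/\<delta>) |x - y|\<close>. Each of the three factors of the density
  is therefore at most a constant times \<open>1 / (1 + |x|)\<^sup>2\<close>.\<close>

lemma away_density_le_decay:
  assumes "\<delta> > 0"
  shows "\<exists>B\<ge>0. \<forall>y1 y2 y3 x. \<bar>away_density \<delta> (y1, y2, y3, x)\<bar> \<le> B * decay x"
proof -
  obtain R where R: "R > 0" "\<And>y. y \<in> knot f \<Longrightarrow> norm y \<le> R"
    using compact_imp_bounded[OF compact_knot[OF f]] unfolding bounded_pos by blast
  define c where "c = 1 + (1 + R) / \<delta>"
  have c: "c > 0" unfolding c_def using assms R by (intro add_pos_pos divide_pos_pos) auto
  have "\<bar>away_density \<delta> (y1, y2, y3, x)\<bar> \<le> (3 * c\<^sup>2) ^ 3 * decay x" for y1 y2 y3 x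
  proof (cases "cyc_ordered f y1 y2 y3 \<and> x \<notin> knot f \<and> infdist x (knot f) > \<delta>")
    case True
    have far: "(1 + norm x) / c \<le> norm (x - y)" if y: "y \<in> knot f" for y
    proof -
      have d: "\<delta> \<le> norm (x - y)" using True infdist_le_dist[OF y, of x] by simp
      have "norm x \<le> norm (x - y) + norm y" using norm_triangle_ineq[of "x - y" y] by simp
      also have "norm y \<le> R" using R y by blast
      finally have "1 + norm x \<le> norm (x - y) + (1 + R)" by simp
      also have "1 + R \<le> (1 + R) / \<delta> * norm (x - y)"
        using d assms R by (simp add: divide_simps mult_left_mono)
      finally show ?thesis using c by (simp add: c_def field_simps)
    qed
    have "\<bar>wedge_density f (y1, y2, y3, x)\<bar> \<le> (3 / ((1 + norm x) / c)\<^sup>2) ^ 3"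
      using c cyc_ordered_in_knot[of y1 y2 y3] True
      by (intro wedge_density_le far divide_pos_pos add_pos_nonneg) auto
    also have "\<dots> = (3 * c\<^sup>2) ^ 3 * (1 / (1 + norm x) ^ 6)"
      by (simp add: power_divide power_mult_distrib flip: power_mult)
    also have "\<dots> \<le> (3 * c\<^sup>2) ^ 3 * decay x"
      by (intro mult_left_mono norm_power_le_decay) auto
    finally show ?thesis using True by (simp add: away_density_eq)
  next
    case False
    then show ?thesis by (simp only: away_density_eq if_False abs_zero) (simp add: decay_nonneg)
  qed
  then show ?thesis by (intro exI[of _ "(3 * c\<^sup>2) ^ 3"]) auto
qed

lemma nn_integral_config_of_last:
  assumes [measurable]: "g \<in> borel_measurable borel"
  shows "(\<integral>\<^sup>+(y1, y2, y3, x). g x \<partial>config_measure f) = (\<integral>\<^sup>+x. g x \<partial>lborel) *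
    emeasure (arc_length f \<Otimes>\<^sub>M (arc_length f \<Otimes>\<^sub>M arc_length f)) UNIV"
proof -
  let ?\<mu> = "arc_length f"
  let ?N = "?\<mu> \<Otimes>\<^sub>M (?\<mu> \<Otimes>\<^sub>M ?\<mu>)"
  interpret arc: finite_measure ?\<mu> by (rule finite_arc_length)
  interpret P2: pair_sigma_finite ?\<mu> ?\<mu> ..
  interpret P3: pair_sigma_finite ?\<mu> "?\<mu> \<Otimes>\<^sub>M ?\<mu>" ..
  have "(\<integral>\<^sup>+(y1, y2, y3, x). g x \<partial>config_measure f) = (\<integral>\<^sup>+(x, q). g x \<partial>(lborel \<Otimes>\<^sub>M ?N))"
    unfolding config_measure_def
    by (subst nn_integral_move_last_outward)
       (auto simp: case_prod_unfold intro: arc.sigma_finite_measure_axioms sigma_finite_lborel)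
  also have "\<dots> = (\<integral>\<^sup>+x. \<integral>\<^sup>+q. g x \<partial>?N \<partial>lborel)"
    by (subst P3.nn_integral_fst[symmetric]) (auto simp: case_prod_unfold)
  also have "\<dots> = (\<integral>\<^sup>+x. g x \<partial>lborel) * emeasure ?N UNIV"
    by (simp add: nn_integral_multc space_pair_measure)
  finally show ?thesis .
qed

lemma integrable_away_density:
  assumes "\<delta> > 0" shows "integrable (config_measure f) (away_density \<delta>)"
proof -
  let ?\<mu> = "arc_length f"
  interpret arc: finite_measure ?\<mu> by (rule finite_arc_length)
  interpret arc3: finite_measure "?\<mu> \<Otimes>\<^sub>M (?\<mu> \<Otimes>\<^sub>M ?\<mu>)"
    by (intro finite_measure_pair_measure arc.finite_measure_axioms)
  obtain B where B: "B \<ge> 0" "\<And>y1 y2 y3 x. \<bar>away_density \<delta> (y1, y2, y3, x)\<bar> \<le> B * decay x"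
    using away_density_le_decay[OF assms] by blast
  have fin: "emeasure (?\<mu> \<Otimes>\<^sub>M (?\<mu> \<Otimes>\<^sub>M ?\<mu>)) UNIV < \<infinity>"
    using arc3.emeasure_finite[of UNIV] by (simp only: top.not_eq_extremum infinity_ennreal_def)
  have "(\<integral>\<^sup>+q. ennreal (norm (away_density \<delta> q)) \<partial>config_measure f) \<le>
      (\<integral>\<^sup>+(y1, y2, y3, x). ennreal B * ennreal (decay x) \<partial>config_measure f)"
    by (intro nn_integral_mono)
       (auto simp: B decay_nonneg ennreal_mult[symmetric] intro!: ennreal_leI split: prod.splits)
  also have "\<dots> < \<infinity>"
    using nn_integral_decay fin
    by (subst nn_integral_config_of_last) (simp_all add: nn_integral_cmult ennreal_mult_less_top)
  finally show ?thesis by (intro integrableI_bounded) auto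
qed

text \<open>Whether a configuration is admitted depends on the \<open>y\<^sub>i\<close> through the cyclic order only and otherwise
  on \<open>x\<close> alone. With \<open>x\<close> outermost, each inner integral is thus either over the
  zero function or the one that vanishes by \<open>integral_cyc_density\<close>.\<close>

lemma integral_away_density:
  assumes "\<delta> > 0" shows "(\<integral>q. away_density \<delta> q \<partial>config_measure f) = 0"
proof -
  let ?\<mu> = "arc_length f" and ?L = "lborel :: (real^3) measure"
  let ?N = "?\<mu> \<Otimes>\<^sub>M (?\<mu> \<Otimes>\<^sub>M ?\<mu>)"
  let ?\<pi> = "\<lambda>(x, y1, y2, y3). (y1, y2, y3, x) :: config"
  interpret arc: finite_measure ?\<mu> by (rule finite_arc_length)
  interpret P2: pair_sigma_finite ?\<mu> ?\<mu> ..
  interpret P3: pair_sigma_finite ?\<mu> "?\<mu> \<Otimes>\<^sub>M ?\<mu>" ..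
  interpret P4: pair_sigma_finite ?L ?N ..
  have C: "config_measure f = distr (?L \<Otimes>\<^sub>M ?N) (config_measure f) ?\<pi>"
    unfolding config_measure_def
    by (rule pair_measure_move_last_outward) (intro arc.sigma_finite_measure_axioms sigma_finite_lborel)+
  have \<pi> [measurable]: "?\<pi> \<in> measurable (?L \<Otimes>\<^sub>M ?N) (config_measure f)"
    unfolding config_measure_def by measurable
  have "integrable (distr (?L \<Otimes>\<^sub>M ?N) (config_measure f) ?\<pi>) (away_density \<delta>)"
    using integrable_away_density[OF assms] C by simp
  then have int: "integrable (?L \<Otimes>\<^sub>M ?N) (\<lambda>q. away_density \<delta> (?\<pi> q))"
    by (rule integrable_distr[OF \<pi>])
  have "(\<integral>q. away_density \<delta> q \<partial>config_measure f) =
      (\<integral>q. away_density \<delta> q \<partial>distr (?L \<Otimes>\<^sub>M ?N) (config_measure f) ?\<pi>)"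
    using C by simp
  also have "\<dots> = (\<integral>q. away_density \<delta> (?\<pi> q) \<partial>(?L \<Otimes>\<^sub>M ?N))"
    by (rule integral_distr[OF \<pi>]) measurable
  also have "\<dots> = (\<integral>x. \<integral>q. away_density \<delta> (?\<pi> (x, q)) \<partial>?N \<partial>?L)"
    by (rule P4.integral_fst'[OF int, symmetric])
  also have "\<dots> = (\<integral>x. 0 \<partial>?L)"
  proof (rule Bochner_Integration.integral_cong[OF refl])
    fix x :: "real^3"
    show "(\<integral>q. away_density \<delta> (?\<pi> (x, q)) \<partial>?N) = 0"
    proof (cases "x \<notin> knot f \<and> infdist x (knot f) > \<delta>")
      case True
      then have "(\<lambda>q. away_density \<delta> (?\<pi> (x, q))) = (\<lambda>(y1, y2, y3). cyc_density x y1 y2 y3)"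
        by (auto simp: away_density_eq cyc_density_def)
      then show ?thesis using integral_cyc_density[of x] True by simp
    next
      case False
      then have "away_density \<delta> (?\<pi> (x, q)) = 0" for q
        by (cases q) (auto simp: away_density_eq)
      then show ?thesis by simp
    qed
  qed
  finally show ?thesis by simp
qed

lemma has_UY_integral_wedge_density: "has_UY_integral f (wedge_density f) 0"
  unfolding has_UY_integral_def set_integrable_def set_lebesgue_integral_def
    away_density_def [symmetric]
proof (intro conjI allI impI integrable_away_density tendsto_eventually)
  show "\<forall>\<^sub>F \<delta> in at_right 0. (\<integral>q. away_density \<delta> q \<partial>config_measure f) = 0"
    using integral_away_density by (auto simp: eventually_at_right_less eventually_at_filter)
qed

lemma has_UY_iterated_integral_wedge_density: "has_UY_iterated_integral f (wedge_density f) 0"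
proof -
  let ?M = "arc_length f \<Otimes>\<^sub>M (arc_length f \<Otimes>\<^sub>M arc_length f)"
  let ?A = "\<lambda>x. {(y1, y2, y3). (y1, y2, y3, x) \<in> UY f}"
  have eq: "(\<lambda>q. indicator (?A x) q *\<^sub>R (case q of (y1, y2, y3) \<Rightarrow> wedge_density f (y1, y2, y3, x))) =
      (\<lambda>(y1, y2, y3). cyc_density x y1 y2 y3)" if "x \<notin> knot f" for x
    using that by (auto simp: UY_iff cyc_density_def indicator_def)
  have zero: "indicator (- knot f) x *\<^sub>R set_lebesgue_integral ?M (?A x)
      (\<lambda>(y1, y2, y3). wedge_density f (y1, y2, y3, x)) = 0" for x
  proof (cases "x \<in> knot f")
    case False
    then show ?thesis
      using arg_cong[OF eq[OF False], of "integral\<^sup>L ?M"] integral_cyc_density[OF False]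
      unfolding set_lebesgue_integral_def by (metis (no_types) scaleR_zero_right)
  qed simp
  show ?thesis
    unfolding has_UY_iterated_integral_def Let_def
  proof (intro conjI allI impI)
    show "set_integrable ?M (?A x) (\<lambda>(y1, y2, y3). wedge_density f (y1, y2, y3, x))"
      if "x \<notin> knot f" for x
      unfolding set_integrable_def eq[OF that] by (rule integrable_cyc_density[OF that])
    show "set_integrable lborel (- knot f) (\<lambda>x. set_lebesgue_integral ?M (?A x)
        (\<lambda>(y1, y2, y3). wedge_density f (y1, y2, y3, x)))"
      unfolding set_integrable_def zero by simp
    show "set_lebesgue_integral lborel (- knot f) (\<lambda>x. set_lebesgue_integral ?M (?A x)
        (\<lambda>(y1, y2, y3). wedge_density f (y1, y2, y3, x))) = 0"
      by (subst set_lebesgue_integral_def) (simp only: zero integral_zero)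
  qed
qed

end

text \<open>The two densities are the same function, so one limit and one iterated integral settle the
  four claims; uniqueness of the limit identifies \<open>E_Y\<close> with it.\<close>

theorem proposition5p1:
  fixes f :: "complex \<Rightarrow> real^3"
  assumes "knot_param f"
  shows "has_UY_integral f (wedge_density f) (E_Y f) \<and>
         has_UY_integral f (det_density f) (E_Y f) \<and>
         has_UY_iterated_integral f (wedge_density f) (E_Y f) \<and>
         has_UY_iterated_integral f (det_density f) (E_Y f) \<and>
         E_Y f = 0"
proof -
  interpret parametrised_knot f by unfold_locales fact
  have "E_Y f = 0"
    unfolding E_Y_def
    by (rule the_equality)
       (fact has_UY_integral_wedge_density, erule has_UY_integral_unique, fact has_UY_integral_wedge_density)
  then show ?thesis
    by (simp add: det_density_eq_wedge_density has_UY_integral_wedge_density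
        has_UY_iterated_integral_wedge_density)
qed

end
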